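(* A VM3-move is not a consequence of VM0-, VM1- and VM2-moves; namely, there is a pair of virtual braids which are related by a VM3-move (a right or left virtual exchange move) and which are not related by any finite sequence of VM0-, VM1- and VM2-moves.
   Context: The virtual braid group $VB_m$ ($m\ge1$) is the group with generators $\sigma_i,\tau_i$ ($1\le i\le m-1$) and relations: $\sigma_i\sigma_j=\sigma_j\sigma_i$ for $|i-j|>1$; $\sigma_i\sigma_{i+1}\sigma_i=\sigma_{i+1}\sigma_i\sigma_{i+1}$; $\tau_i^2=1$; $\tau_i\tau_j=\tau_j\tau_i$ for $|i-j|>1$; $\tau_i\tau_{i+1}\tau_i=\tau_{i+1}\tau_i\tau_{i+1}$; $\sigma_i\tau_j=\tau_j\sigma_i$ for $|i-j|>1$; $\sigma_i\tau_{i+1}\tau_i=\tau_{i+1}\tau_i\sigma_{i+1}$. Its elements are called virtual braids of degree $m$. The homomorphism $\iota_s^t:VB_m\to VB_{m+s+t}$ is given by $\sigma_i\mapsto\sigma_{i+s}$, $\tau_i\mapsto\tau_{i+s}$ (adding $s$ trivial strands to the left and $t$ to the right). Moves. (VM0) a braid move: applying a defining relation of the virtual braid group (trivial on elements of $VB_m$; it matters only for words/diagrams). (VM1) a conjugation: $b_1\mapsto b_2^{-1}b_1b_2$ with $b_1,b_2\in VB_m$. (VM2) a right stabilization of positive, negative or virtual type, replacing $b\in VB_m$ by $\iota_0^1(b)\sigma_m$, $\iota_0^1(b)\sigma_m^{-1}$ or $\iota_0^1(b)\tau_m\in VB_{m+1}$, and its inverse operation. (VM3) a right virtual exchange move $\iota_0^1(b_1)\sigma_m^{-1}\iota_0^1(b_2)\sigma_m\leftrightarrow\iota_0^1(b_1)\tau_m\iota_0^1(b_2)\tau_m$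 in $VB_{m+1}$, or a left virtual exchange move $\iota_1^0(b_1)\sigma_1^{-1}\iota_1^0(b_2)\sigma_1\leftrightarrow\iota_1^0(b_1)\tau_1\iota_1^0(b_2)\tau_1$ in $VB_{m+1}$, where $b_1,b_2\in VB_m$. *)

theory Defs
  imports "HOL-Algebra.Group"
begin

section \<open>Virtual braid groups\<close>

datatype vgen = Sg nat | Tu nat

text \<open>A letter \<open>(g, True)\<close> stands for the generator \<open>g\<close>, and \<open>(g, False)\<close> for its formal inverse.\<close>

type_synonym vletter = "vgen \<times> bool"
type_synonym vword = "vletter list"

abbreviation sg :: "nat \<Rightarrow> vletter" where "sg i \<equiv> (Sg i, True)"
abbreviation tu :: "nat \<Rightarrow> vletter" where "tu i \<equiv> (Tu i, True)"

fun vgen_index :: "vgen \<Rightarrow> nat" where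
  "vgen_index (Sg i) = i"
| "vgen_index (Tu i) = i"

definition vb_words :: "nat \<Rightarrow> vword set" where
  "vb_words m = {w. \<forall>x\<in>set w. 1 \<le> vgen_index (fst x) \<and> vgen_index (fst x) < m}"

text \<open>The relations, stated for all indices; \<open>vb_step\<close> below restricts them to the index range
  of degree \<open>m\<close>.  The rule \<open>cancel\<close> is the free-group relation, which makes
  \<open>(g, False)\<close> the inverse of \<open>(g, True)\<close>.\<close>

inductive vb_rel :: "vword \<Rightarrow> vword \<Rightarrow> bool" where
  cancel: "vb_rel [(g, e), (g, \<not> e)] []"
| sg_comm: "\<bar>int i - int j\<bar> > 1 \<Longrightarrow> vb_rel [sg i, sg j] [sg j, sg i]"
| sg_braid: "vb_rel [sg i, sg (i + 1), sg i] [sg (i + 1), sg i, sg (i + 1)]"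
| tu_sq: "vb_rel [tu i, tu i] []"
| tu_comm: "\<bar>int i - int j\<bar> > 1 \<Longrightarrow> vb_rel [tu i, tu j] [tu j, tu i]"
| tu_braid: "vb_rel [tu i, tu (i + 1), tu i] [tu (i + 1), tu i, tu (i + 1)]"
| sg_tu_comm: "\<bar>int i - int j\<bar> > 1 \<Longrightarrow> vb_rel [sg i, tu j] [tu j, sg i]"
| mixed: "vb_rel [sg i, tu (i + 1), tu i] [tu (i + 1), tu i, sg (i + 1)]"

definition vb_step :: "nat \<Rightarrow> vword \<Rightarrow> vword \<Rightarrow> bool" where
  "vb_step m w w' \<longleftrightarrow> w \<in> vb_words m \<and> w' \<in> vb_words m \<and>
     (\<exists>u v l r. vb_rel l r \<and> w = u @ l @ v \<and> w' = u @ r @ v)"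

definition vb_class :: "nat \<Rightarrow> vword \<Rightarrow> vword set" where
  "vb_class m w = {w'. equivclp (vb_step m) w w'}"

definition VB :: "nat \<Rightarrow> vword set monoid" where
  "VB m = \<lparr> carrier = vb_class m ` vb_words m,
            monoid.mult = (\<lambda>A B. \<Union>u\<in>A. \<Union>v\<in>B. vb_class m (u @ v)),
            one = vb_class m [] \<rparr>"

abbreviation vb_sigma :: "nat \<Rightarrow> nat \<Rightarrow> vword set" where
  "vb_sigma m i \<equiv> vb_class m [sg i]"

abbreviation vb_tau :: "nat \<Rightarrow> nat \<Rightarrow> vword set" where
  "vb_tau m i \<equiv> vb_class m [tu i]"

fun vgen_shift :: "nat \<Rightarrow> vgen \<Rightarrow> vgen" where
  "vgen_shift s (Sg i) = Sg (i + s)"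
| "vgen_shift s (Tu i) = Tu (i + s)"

definition vword_shift :: "nat \<Rightarrow> vword \<Rightarrow> vword" where
  "vword_shift s = map (map_prod (vgen_shift s) id)"

text \<open>\<open>vb_iota m s t\<close> is the map \<open>\<iota>\<^sub>s\<^sup>t\<close> from \<open>VB m\<close> to \<open>VB (m + s + t)\<close>; the source degree is an
  explicit argument.\<close>

definition vb_iota :: "nat \<Rightarrow> nat \<Rightarrow> nat \<Rightarrow> vword set \<Rightarrow> vword set" where
  "vb_iota m s t A = (\<Union>w\<in>A. vb_class (m + s + t) (vword_shift s w))"

subsection \<open>Well-definedness\<close>

lemma vb_words_append [simp]: "u @ v \<in> vb_words m \<longleftrightarrow> u \<in> vb_words m \<and> v \<in> vb_words m"
  by (auto simp: vb_words_def)

lemma vb_words_Nil [simp]: "[] \<in> vb_words m"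
  by (simp add: vb_words_def)

lemma vb_class_eqI: "equivclp (vb_step m) u v \<Longrightarrow> vb_class m u = vb_class m v"
  unfolding vb_class_def by (auto elim: equivclp_trans dest: equivclp_sym)

lemma vb_class_self [simp]: "w \<in> vb_class m w"
  by (simp add: vb_class_def)

lemma vb_class_eq_iff: "vb_class m u = vb_class m v \<longleftrightarrow> equivclp (vb_step m) u v"
proof
  assume "vb_class m u = vb_class m v"
  then have "v \<in> vb_class m u" by simp
  then show "equivclp (vb_step m) u v" by (simp add: vb_class_def)
qed (rule vb_class_eqI)

lemma equivclp_vb_words:
  assumes "equivclp (vb_step m) u v" "u \<in> vb_words m"
  shows "v \<in> vb_words m"
  using assms by (induction rule: equivclp_induct) (auto simp: vb_step_def)

lemma equivclp_map:
  assumes "equivclp R x y" "\<And>x y. R x y \<Longrightarrow> equivclp S (f x) (f y)"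
  shows "equivclp S (f x) (f y)"
  using assms(1)
proof (induction rule: equivclp_induct)
  case (step y z)
  then have "equivclp S (f y) (f z)"
    using assms(2)[of y z] assms(2)[of z y] by (auto intro: equivclp_sym)
  with step.IH show ?case by (rule equivclp_trans)
qed simp

lemma vb_step_context:
  assumes "vb_step m w w'" "u \<in> vb_words m" "v \<in> vb_words m"
  shows "vb_step m (u @ w @ v) (u @ w' @ v)"
proof -
  from assms(1) obtain a b l r where *: "vb_rel l r" "w = a @ l @ b" "w' = a @ r @ b"
    by (auto simp: vb_step_def)
  have "u @ w @ v = (u @ a) @ l @ (b @ v)" "u @ w' @ v = (u @ a) @ r @ (b @ v)"
    using * by auto
  moreover have "u @ w @ v \<in> vb_words m" "u @ w' @ v \<in> vb_words m"
    using assms by (auto simp: vb_step_def)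
  ultimately show ?thesis
    unfolding vb_step_def using *(1) by blast
qed

lemma equivclp_append:
  assumes "equivclp (vb_step m) u u'" "equivclp (vb_step m) v v'"
    and "u \<in> vb_words m" "v \<in> vb_words m"
  shows "equivclp (vb_step m) (u @ v) (u' @ v')"
proof -
  have u': "u' \<in> vb_words m" using equivclp_vb_words assms by blast
  have "equivclp (vb_step m) (u @ v) (u' @ v)"
    by (rule equivclp_map[where f = "\<lambda>x. x @ v", OF assms(1)])
      (use vb_step_context[where u = "[]" and v = v] assms(4) in auto)
  moreover have "equivclp (vb_step m) (u' @ v) (u' @ v')"
    by (rule equivclp_map[where f = "\<lambda>x. u' @ x", OF assms(2)])
      (use vb_step_context[where u = u' and v = "[]"] u' in auto)
  ultimately show ?thesis by (rule equivclp_trans)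
qed

lemma vb_carrier: "carrier (VB m) = vb_class m ` vb_words m"
  by (simp add: VB_def)

lemma vb_one: "\<one>\<^bsub>VB m\<^esub> = vb_class m []"
  by (simp add: VB_def)

lemma vb_mult:
  assumes "u \<in> vb_words m" "v \<in> vb_words m"
  shows "vb_class m u \<otimes>\<^bsub>VB m\<^esub> vb_class m v = vb_class m (u @ v)"
proof -
  have "vb_class m (u' @ v') = vb_class m (u @ v)"
    if "u' \<in> vb_class m u" "v' \<in> vb_class m v" for u' v'
    using that equivclp_append[OF _ _ assms, of u' v']
    by (metis mem_Collect_eq vb_class_def vb_class_eqI)
  then have "(\<Union>u'\<in>vb_class m u. \<Union>v'\<in>vb_class m v. vb_class m (u' @ v')) = vb_class m (u @ v)"
    using vb_class_self[of u m] vb_class_self[of v m] by blast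
  then show ?thesis
    by (simp add: VB_def)
qed

definition vword_inv :: "vword \<Rightarrow> vword" where
  "vword_inv w = map (map_prod id Not) (rev w)"

lemma vword_inv_words [simp]: "vword_inv w \<in> vb_words m \<longleftrightarrow> w \<in> vb_words m"
  by (auto simp: vword_inv_def vb_words_def)

lemma vword_inv_cancel:
  assumes "w \<in> vb_words m"
  shows "equivclp (vb_step m) (vword_inv w @ w) []"
  using assms
proof (induction w)
  case Nil
  then show ?case by (simp add: vword_inv_def)
next
  case (Cons x w)
  obtain g e where x: "x = (g, e)" by (cases x)
  have w: "w \<in> vb_words m" and x': "[x] \<in> vb_words m"
    using Cons.prems by (auto simp: vb_words_def)
  have eq: "vword_inv (x # w) @ x # w = vword_inv w @ [(g, \<not> e), (g, e)] @ w"
    by (simp add: vword_inv_def x)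
  have "vb_rel [(g, \<not> e), (g, e)] []" using cancel[of g "\<not> e"] by simp
  moreover have "[(g, \<not> e), (g, e)] \<in> vb_words m"
    using x' by (auto simp: vb_words_def x)
  ultimately have "vb_step m (vword_inv (x # w) @ x # w) (vword_inv w @ w)"
    unfolding vb_step_def eq using w
    by (metis append_Nil vb_words_append vword_inv_words)
  then show ?case
    using Cons.IH[OF w] by (blast intro: equivclp_trans r_into_equivclp)
qed

lemma vb_group: "group (VB m)"
proof (rule groupI)
  fix x y
  assume "x \<in> carrier (VB m)" "y \<in> carrier (VB m)"
  then show "x \<otimes>\<^bsub>VB m\<^esub> y \<in> carrier (VB m)"
    by (auto simp: vb_carrier vb_mult)
next
  fix x y z
  assume "x \<in> carrier (VB m)" "y \<in> carrier (VB m)" "z \<in> carrier (VB m)"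
  then show "x \<otimes>\<^bsub>VB m\<^esub> y \<otimes>\<^bsub>VB m\<^esub> z = x \<otimes>\<^bsub>VB m\<^esub> (y \<otimes>\<^bsub>VB m\<^esub> z)"
    by (auto simp: vb_carrier vb_mult)
next
  fix x
  assume "x \<in> carrier (VB m)"
  then obtain w where w: "x = vb_class m w" "w \<in> vb_words m"
    by (auto simp: vb_carrier)
  show "\<one>\<^bsub>VB m\<^esub> \<otimes>\<^bsub>VB m\<^esub> x = x"
    using w by (simp add: vb_one vb_mult)
  have "vb_class m (vword_inv w) \<otimes>\<^bsub>VB m\<^esub> x = \<one>\<^bsub>VB m\<^esub>"
    using w by (simp add: vb_one vb_mult vb_class_eq_iff vword_inv_cancel)
  then show "\<exists>y\<in>carrier (VB m). y \<otimes>\<^bsub>VB m\<^esub> x = \<one>\<^bsub>VB m\<^esub>"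
    using w by (auto simp: vb_carrier)
qed (auto simp: vb_carrier vb_one)

lemma vgen_index_shift [simp]: "vgen_index (vgen_shift s g) = vgen_index g + s"
  by (cases g) auto

lemma vword_shift_words:
  assumes "w \<in> vb_words m"
  shows "vword_shift s w \<in> vb_words (m + s + t)"
  using assms by (force simp: vb_words_def vword_shift_def)

lemma vb_rel_shift:
  assumes "vb_rel l r"
  shows "vb_rel (vword_shift s l) (vword_shift s r)"
  using assms
proof cases
  case (sg_braid i)
  then show ?thesis using vb_rel.sg_braid[of "i + s"] by (simp add: vword_shift_def)
next
  case (tu_braid i)
  then show ?thesis using vb_rel.tu_braid[of "i + s"] by (simp add: vword_shift_def)
next
  case (mixed i)
  then show ?thesis using vb_rel.mixed[of "i + s"] by (simp add: vword_shift_def)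
qed (auto simp: vword_shift_def intro: vb_rel.intros)

lemma vb_step_shift:
  assumes "vb_step m w w'"
  shows "vb_step (m + s + t) (vword_shift s w) (vword_shift s w')"
proof -
  from assms obtain a b l r where *: "vb_rel l r" "w = a @ l @ b" "w' = a @ r @ b"
    and w: "w \<in> vb_words m" "w' \<in> vb_words m"
    by (auto simp: vb_step_def)
  have "vword_shift s w = vword_shift s a @ vword_shift s l @ vword_shift s b"
    "vword_shift s w' = vword_shift s a @ vword_shift s r @ vword_shift s b"
    using * by (auto simp: vword_shift_def)
  then show ?thesis
    unfolding vb_step_def
    using vb_rel_shift[OF *(1), of s] vword_shift_words[OF w(1)] vword_shift_words[OF w(2)]
    by blast
qed

lemma vb_iota_class: "vb_iota m s t (vb_class m w) = vb_class (m + s + t) (vword_shift s w)"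
proof -
  have "vb_class (m + s + t) (vword_shift s w') = vb_class (m + s + t) (vword_shift s w)"
    if "w' \<in> vb_class m w" for w'
    using equivclp_map[where f = "vword_shift s" and S = "vb_step (m + s + t)" and R = "vb_step m"]
      that vb_step_shift
    by (metis (lifting) mem_Collect_eq r_into_equivclp vb_class_def vb_class_eqI)
  then show ?thesis
    unfolding vb_iota_def using vb_class_self[of w m] by blast
qed

lemma vb_iota_hom: "vb_iota m s t \<in> hom (VB m) (VB (m + s + t))"
proof -
  have "vword_shift s (u @ v) = vword_shift s u @ vword_shift s v" for u v
    by (simp add: vword_shift_def)
  then show ?thesis
    by (auto simp: hom_def vb_carrier vb_mult vb_iota_class vword_shift_words)
qed

lemma vb_iota_sigma: "vb_iota m s t (vb_sigma m i) = vb_sigma (m + s + t) (i + s)"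
  by (simp add: vb_iota_class vword_shift_def)

lemma vb_iota_tau: "vb_iota m s t (vb_tau m i) = vb_tau (m + s + t) (i + s)"
  by (simp add: vb_iota_class vword_shift_def)

section \<open>Moves\<close>

text \<open>A virtual braid is recorded together with its degree, so that \<open>VM2\<close> relates braids of
  different degrees.\<close>

type_synonym vbraid = "nat \<times> vword set"

definition VM0 :: "vbraid rel" where
  "VM0 = {((m, vb_class m w), (m, vb_class m w')) | m w w'. m \<ge> 1 \<and> symclp (vb_step m) w w'}"

definition VM1 :: "vbraid rel" where
  "VM1 = {((m, b1), (m, inv\<^bsub>VB m\<^esub> b2 \<otimes>\<^bsub>VB m\<^esub> b1 \<otimes>\<^bsub>VB m\<^esub> b2)) | m b1 b2.
            m \<ge> 1 \<and> b1 \<in> carrier (VB m) \<and> b2 \<in> carrier (VB m)}"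

text \<open>The stabilization direction of the move only; destabilizations are its converse.\<close>

definition VM2_stab :: "vbraid rel" where
  "VM2_stab = {((m, b), (m + 1, vb_iota m 0 1 b \<otimes>\<^bsub>VB (m + 1)\<^esub> c)) | m b c.
            m \<ge> 1 \<and> b \<in> carrier (VB m) \<and>
            c \<in> {vb_sigma (m + 1) m, inv\<^bsub>VB (m + 1)\<^esub> vb_sigma (m + 1) m, vb_tau (m + 1) m}}"

definition VM2 :: "vbraid rel" where
  "VM2 = VM2_stab \<union> VM2_stab\<inverse>"

definition VM3_right :: "vbraid rel" where
  "VM3_right =
     {((m + 1, vb_iota m 0 1 b1 \<otimes>\<^bsub>VB (m + 1)\<^esub> inv\<^bsub>VB (m + 1)\<^esub> vb_sigma (m + 1) m
                 \<otimes>\<^bsub>VB (m + 1)\<^esub> vb_iota m 0 1 b2 \<otimes>\<^bsub>VB (m + 1)\<^esub> vb_sigma (m + 1) m),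
       (m + 1, vb_iota m 0 1 b1 \<otimes>\<^bsub>VB (m + 1)\<^esub> vb_tau (m + 1) m
                 \<otimes>\<^bsub>VB (m + 1)\<^esub> vb_iota m 0 1 b2 \<otimes>\<^bsub>VB (m + 1)\<^esub> vb_tau (m + 1) m)) | m b1 b2.
      m \<ge> 1 \<and> b1 \<in> carrier (VB m) \<and> b2 \<in> carrier (VB m)}"

definition VM3_left :: "vbraid rel" where
  "VM3_left =
     {((m + 1, vb_iota m 1 0 b1 \<otimes>\<^bsub>VB (m + 1)\<^esub> inv\<^bsub>VB (m + 1)\<^esub> vb_sigma (m + 1) 1
                 \<otimes>\<^bsub>VB (m + 1)\<^esub> vb_iota m 1 0 b2 \<otimes>\<^bsub>VB (m + 1)\<^esub> vb_sigma (m + 1) 1),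
       (m + 1, vb_iota m 1 0 b1 \<otimes>\<^bsub>VB (m + 1)\<^esub> vb_tau (m + 1) 1
                 \<otimes>\<^bsub>VB (m + 1)\<^esub> vb_iota m 1 0 b2 \<otimes>\<^bsub>VB (m + 1)\<^esub> vb_tau (m + 1) 1)) | m b1 b2.
      m \<ge> 1 \<and> b1 \<in> carrier (VB m) \<and> b2 \<in> carrier (VB m)}"

definition VM3 :: "vbraid rel" where
  "VM3 = VM3_right \<union> VM3_right\<inverse> \<union> VM3_left \<union> VM3_left\<inverse>"

end

theory Submission imports Defs "HOL-Library.Numeral_Type" begin

text \<open>Let \<open>VB\<^sub>m\<close> act on \<open>X\<^sup>m\<close>, where \<open>\<tau>\<^sub>i\<close> is the flip and \<open>\<sigma>\<^sub>i\<close> is a set-theoretic solution \<open>S\<close> of the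
  Yang--Baxter equation, applied to the coordinates \<open>i\<close> and \<open>i + 1\<close>. The number of fixed points of a
  braid is a conjugation invariant, and its parity is also invariant under right stabilizations as
  soon as, for all \<open>x, x'\<close>, the number of \<open>y\<close> with \<open>S (x, y) = (x', y)\<close> is odd if \<open>x = x'\<close> and zero
  otherwise. A virtual exchange move preserves it when \<open>S\<close> is non-degenerate, so \<open>S\<close> has to be
  degenerate. Colour the components of the closure by \<open>A\<close> and \<open>B\<close>, smooth the real crossings of \<open>A\<close>
  with itself, and put on each resulting circle a label in \<open>\<int>/3\<close> that changes by the sign of the
  intersection whenever the circle really crosses a \<open>B\<close>-strand: this \<open>S\<close> is the identity on pairs of
  \<open>A\<close>-states. In the exchange move below, the \<open>\<sigma>\<close>-side has 40 fixed points and the \<open>\<tau>\<close>-side has 7.\<close>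

section \<open>The action of virtual braid words on colourings\<close>

text \<open>\<open>None\<close> is the colour of a \<open>B\<close>-strand, \<open>Some a\<close> that of an \<open>A\<close>-strand with label \<open>a\<close>.\<close>

type_synonym colour = "3 option"

fun crossing :: "colour \<times> colour \<Rightarrow> colour \<times> colour" where
  "crossing (None, None) = (None, None)"
| "crossing (Some a, Some b) = (Some a, Some b)"
| "crossing (Some a, None) = (None, Some (a + 1))"
| "crossing (None, Some a) = (Some (a - 1), None)"

definition pair_act :: "('a \<times> 'a \<Rightarrow> 'a \<times> 'a) \<Rightarrow> nat \<Rightarrow> (nat \<Rightarrow> 'a) \<Rightarrow> nat \<Rightarrow> 'a" where
  "pair_act F i s = s(i := fst (F (s i, s (i + 1))), i + 1 := snd (F (s i, s (i + 1))))"

fun gen_act :: "vgen \<Rightarrow> (nat \<Rightarrow> colour) \<Rightarrow> nat \<Rightarrow> colour" where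
  "gen_act (Sg i) = pair_act crossing i"
| "gen_act (Tu i) = pair_act prod.swap i"

text \<open>Exponents are dropped: each generator acts by an involution, hence like its inverse. The
  leftmost letter acts first.\<close>

definition word_act :: "vword \<Rightarrow> (nat \<Rightarrow> colour) \<Rightarrow> nat \<Rightarrow> colour" where
  "word_act w = fold (\<lambda>x. gen_act (fst x)) w"

lemma word_act_Nil [simp]: "word_act [] s = s"
  and word_act_Cons [simp]: "word_act (x # w) s = word_act w (gen_act (fst x) s)"
  and word_act_append [simp]: "word_act (u @ v) s = word_act v (word_act u s)"
  by (simp_all add: word_act_def)

lemma crossing_crossing [simp]: "crossing (crossing p) = p"
  by (cases p rule: crossing.cases) auto

lemma pair_act_involutive:
  assumes "\<And>p. F (F p) = p"
  shows "pair_act F i (pair_act F i s) = s"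
  by (auto simp: pair_act_def assms fun_eq_iff)

lemma gen_act_involutive [simp]: "gen_act g (gen_act g s) = s"
  by (cases g) (simp_all add: pair_act_involutive)

lemma pair_act_commute:
  assumes "\<bar>int i - int j\<bar> > 1"
  shows "pair_act F i (pair_act G j s) = pair_act G j (pair_act F i s)"
proof -
  have "i \<noteq> j" "i + 1 \<noteq> j" "i \<noteq> j + 1" using assms by auto
  then show ?thesis by (auto simp: pair_act_def fun_eq_iff)
qed

text \<open>On colours alone \<open>crossing\<close> is the flip, which satisfies the braid
  relation. The A-states keep their order, and label minus place is constant along each of them, so
  the labels agree as well.\<close>

lemma pair_act_crossing_braid:
  "pair_act crossing i (pair_act crossing (Suc i) (pair_act crossing i s))
   = pair_act crossing (Suc i) (pair_act crossing i (pair_act crossing (Suc i) s))"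
  by (cases "s i"; cases "s (Suc i)"; cases "s (Suc (Suc i))") (auto simp: pair_act_def fun_eq_iff)

lemma word_act_rel:
  assumes "vb_rel l r"
  shows "word_act l s = word_act r s"
  using assms
proof cases
  case (sg_braid i)
  then show ?thesis by (simp add: pair_act_crossing_braid)
next
  case (tu_braid i)
  then show ?thesis by (auto simp: pair_act_def fun_eq_iff)
next
  \<comment> \<open>This holds for any pair map: the flips only carry the pair past the third
    strand.\<close>
  case (mixed i)
  then show ?thesis by (auto simp: pair_act_def fun_eq_iff)
qed (auto simp: pair_act_commute pair_act_involutive)

lemma word_act_equiv:
  assumes "equivclp (vb_step m) w w'"
  shows "word_act w = word_act w'"
  using assms
proof (induction rule: equivclp_induct)
  case (step y z)
  have "word_act u = word_act v" if "vb_step m u v" for u v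
    using that word_act_rel by (fastforce simp: vb_step_def)
  with step show ?case by metis
qed simp

section \<open>Fixed colourings and conjugation\<close>

abbreviation colourings :: "nat \<Rightarrow> (nat \<Rightarrow> colour) set" where
  "colourings m \<equiv> {1..m} \<rightarrow>\<^sub>E UNIV"

definition fixed_colourings :: "nat \<Rightarrow> vword \<Rightarrow> (nat \<Rightarrow> colour) set" where
  "fixed_colourings m w = {s \<in> colourings m. word_act w s = s}"

lemma finite_fixed_colourings [simp]: "finite (fixed_colourings m w)"
  by (simp add: fixed_colourings_def finite_PiE)

lemma gen_act_outside:
  assumes "j < vgen_index g \<or> vgen_index g + 1 < j"
  shows "gen_act g s j = s j"
  using assms by (cases g) (auto simp: pair_act_def)

lemma word_act_outside:
  assumes "w \<in> vb_words m" "j \<notin> {1..m}"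
  shows "word_act w s j = s j"
  using assms
proof (induction w arbitrary: s)
  case (Cons x w)
  then show ?case by (auto simp: vb_words_def gen_act_outside)
qed simp

lemma word_act_colourings:
  assumes "w \<in> vb_words m" "s \<in> colourings m"
  shows "word_act w s \<in> colourings m"
  using assms word_act_outside[OF assms(1)] by (auto simp: PiE_iff extensional_def)

lemma gen_act_upd:
  assumes "j \<noteq> vgen_index g" "j \<noteq> vgen_index g + 1"
  shows "gen_act g (s(j := y)) = (gen_act g s)(j := y)"
  using assms by (cases g) (auto simp: pair_act_def fun_eq_iff)

lemma word_act_upd:
  assumes "w \<in> vb_words m"
  shows "word_act w (s(Suc m := y)) = (word_act w s)(Suc m := y)"
  using assms
proof (induction w arbitrary: s)
  case (Cons x w)
  then have "gen_act (fst x) (s(Suc m := y)) = (gen_act (fst x) s)(Suc m := y)"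
    by (intro gen_act_upd) (auto simp: vb_words_def)
  with Cons show ?case by (simp add: vb_words_def del: fun_upd_apply)
qed simp

lemma word_act_inv [simp]: "word_act w (word_act (vword_inv w) s) = s"
  "word_act (vword_inv w) (word_act w s) = s"
  by (induction w arbitrary: s) (auto simp: vword_inv_def)

text \<open>The action of \<open>v\<close> carries the fixed colourings of \<open>u\<close> onto
  those of the conjugate.\<close>

lemma card_fixed_colourings_conj:
  assumes "u \<in> vb_words m" "v \<in> vb_words m"
  shows "card (fixed_colourings m (vword_inv v @ u @ v)) = card (fixed_colourings m u)"
proof -
  have "word_act v s \<in> fixed_colourings m (vword_inv v @ u @ v)" if "s \<in> fixed_colourings m u" for s
    using that word_act_colourings[OF assms(2), of s] by (simp add: fixed_colourings_def)
  moreover have "word_act (vword_inv v) s \<in> fixed_colourings m u"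
    if "s \<in> fixed_colourings m (vword_inv v @ u @ v)" for s
  proof -
    have "word_act u (word_act (vword_inv v) s) = word_act (vword_inv v) s"
      using that by (metis (mono_tags, lifting) fixed_colourings_def mem_Collect_eq word_act_append word_act_inv(2))
    with that show ?thesis
      using word_act_colourings[of "vword_inv v" m s] assms(2) by (simp add: fixed_colourings_def)
  qed
  ultimately have
    "bij_betw (word_act v) (fixed_colourings m u) (fixed_colourings m (vword_inv v @ u @ v))"
    by (intro bij_betw_byWitness[where f' = "word_act (vword_inv v)"]) auto
  then show ?thesis by (simp add: bij_betw_same_card)
qed

section \<open>Parity under stabilization\<close>

text \<open>Since \<open>w\<close> leaves coordinate m + 1 alone, the last letter must return the
  state \<open>y\<close> found there. By the hypothesis on \<open>F\<close> it then leaves the state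
  at m unchanged too, so \<open>w\<close> itself fixes the first m coordinates. The new fixed
  colourings thus fibre over those of \<open>w\<close>, with fibres \<open>K (t m)\<close> of odd
  size.\<close>

lemma even_card_fixed_colourings_stab:
  assumes w: "w \<in> vb_words m" and m: "m \<ge> 1"
    and c: "\<And>s. gen_act (fst c) s = pair_act F m s"
    and F: "\<And>x x' y. F (x, y) = (x', y) \<longleftrightarrow> x' = x \<and> y \<in> K x"
    and K: "\<And>x. odd (card (K x))" and fin: "\<And>x. finite (K x)"
  shows "even (card (fixed_colourings (Suc m) (w @ [c]))) \<longleftrightarrow> even (card (fixed_colourings m w))"
proof -
  let ?T = "SIGMA t:fixed_colourings m w. K (t m)"
  let ?g = "\<lambda>(t, y). t(Suc m := y) :: nat \<Rightarrow> colour"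
  have fixed_iff: "word_act (w @ [c]) (t(Suc m := y)) = t(Suc m := y) \<longleftrightarrow> word_act w t = t \<and> y \<in> K (t m)"
    if t: "t \<in> colourings m" for t y
  proof -
    let ?t = "word_act w t" and ?p = "F (word_act w t m, y)"
    have out: "?t (Suc m) = t (Suc m)"
      using word_act_outside[OF w] by simp
    have act: "word_act (w @ [c]) (t(Suc m := y)) = ?t(m := fst ?p, Suc m := snd ?p)"
      using m by (simp add: word_act_upd[OF w] c pair_act_def fun_eq_iff)
    have "?t(m := fst ?p, Suc m := snd ?p) = t(Suc m := y) \<longleftrightarrow> (\<forall>j. j \<noteq> m \<longrightarrow> ?t j = t j) \<and> ?p = (t m, y)"
      (is "?l = ?r \<longleftrightarrow> _")
    proof
      assume eq: "?l = ?r"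
      have "?t j = t j" if "j \<noteq> m" for j
        using fun_cong[OF eq, of j] out that by (cases "j = Suc m") auto
      then show "(\<forall>j. j \<noteq> m \<longrightarrow> ?t j = t j) \<and> ?p = (t m, y)"
        using fun_cong[OF eq, of m] fun_cong[OF eq, of "Suc m"] by (simp add: prod_eq_iff)
    qed auto
    also have "\<dots> \<longleftrightarrow> ?t = t \<and> y \<in> K (t m)"
    proof
      assume *: "(\<forall>j. j \<noteq> m \<longrightarrow> ?t j = t j) \<and> ?p = (t m, y)"
      then have m: "t m = ?t m \<and> y \<in> K (?t m)" by (simp only: F)
      have "?t = t"
      proof
        show "?t j = t j" for j using m * by (cases "j = m") simp_all
      qed
      with m show "?t = t \<and> y \<in> K (t m)" by (simp only:)
    next
      assume "?t = t \<and> y \<in> K (t m)"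
      then show "(\<forall>j. j \<noteq> m \<longrightarrow> ?t j = t j) \<and> ?p = (t m, y)" by (simp add: F)
    qed
    finally show ?thesis by (simp only: act)
  qed
  have "fixed_colourings (Suc m) (w @ [c]) = ?g ` ?T"
  proof (intro equalityI subsetI)
    fix s assume s: "s \<in> fixed_colourings (Suc m) (w @ [c])"
    \<comment> \<open>Extensionality of \<open>colourings m\<close> forces the value
      \<open>undefined\<close> at m + 1.\<close>
    define t where "t = s(Suc m := undefined)"
    have t: "t \<in> colourings m" and st: "t(Suc m := s (Suc m)) = s"
      using s by (auto simp: t_def fixed_colourings_def PiE_iff extensional_def)
    have "(t, s (Suc m)) \<in> ?T"
      using s t fixed_iff[OF t, of "s (Suc m)"] unfolding st by (simp add: fixed_colourings_def)
    then show "s \<in> ?g ` ?T"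
      using st by (intro image_eqI[of _ _ "(t, s (Suc m))"]) simp_all
  next
    fix s assume "s \<in> ?g ` ?T"
    then obtain t y where ty: "s = t(Suc m := y)" "t \<in> fixed_colourings m w" "y \<in> K (t m)" by auto
    then have "s \<in> colourings (Suc m)"
      by (auto simp: fixed_colourings_def PiE_iff extensional_def)
    with ty fixed_iff[of t y] show "s \<in> fixed_colourings (Suc m) (w @ [c])"
      by (simp add: fixed_colourings_def)
  qed
  moreover have "inj_on ?g ?T"
  proof (rule inj_onI, clarify)
    fix t y t' y' assume *: "t \<in> fixed_colourings m w" "t' \<in> fixed_colourings m w"
      and eq: "t(Suc m := y) = t'(Suc m := y')"
    from * have Suc: "t (Suc m) = t' (Suc m)"
      by (auto simp: fixed_colourings_def PiE_iff extensional_def)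
    have "t i = t' i" for i
      using fun_cong[OF eq, of i] Suc by (cases "i = Suc m") auto
    then show "t = t' \<and> y = y'"
      using fun_cong[OF eq, of "Suc m"] by auto
  qed
  ultimately have "card (fixed_colourings (Suc m) (w @ [c])) = (\<Sum>t\<in>fixed_colourings m w. card (K (t m)))"
    using fin by (simp add: card_image)
  then show ?thesis using K by (simp add: even_sum_iff)
qed

lemma card_range_Some: "card (range (Some :: 3 \<Rightarrow> colour)) = 3"
  by (simp add: card_image)

text \<open>An A-strand closes up with any of the three labels, a B-strand only with B. The fibres
  have 3 or 1 elements; this is where the odd number of labels matters.\<close>

lemma even_card_fixed_colourings_stab_sigma:
  assumes "w \<in> vb_words m" "m \<ge> 1"
  shows "even (card (fixed_colourings (Suc m) (w @ [(Sg m, e)]))) \<longleftrightarrow> even (card (fixed_colourings m w))"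
proof (rule even_card_fixed_colourings_stab[OF assms, where F = crossing
      and K = "\<lambda>x. if x = None then {None} else range Some"])
  show "crossing (x, y) = (x', y) \<longleftrightarrow> x' = x \<and> y \<in> (if x = None then {None} else range Some)" for x x' y
    by (cases x; cases y) auto
qed (auto simp: card_range_Some)

lemma even_card_fixed_colourings_stab_tau:
  assumes "w \<in> vb_words m" "m \<ge> 1"
  shows "even (card (fixed_colourings (Suc m) (w @ [(Tu m, e)]))) \<longleftrightarrow> even (card (fixed_colourings m w))"
  by (rule even_card_fixed_colourings_stab[OF assms, where F = prod.swap and K = "\<lambda>x. {x}"]) auto

section \<open>Invariance of the parity under the moves\<close>

lemma vb_inv_class:
  assumes "w \<in> vb_words m"
  shows "inv\<^bsub>VB m\<^esub> vb_class m w = vb_class m (vword_inv w)"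
proof (rule group.inv_equality[OF vb_group])
  show "vb_class m (vword_inv w) \<otimes>\<^bsub>VB m\<^esub> vb_class m w = \<one>\<^bsub>VB m\<^esub>"
    using assms by (simp add: vb_mult vb_one vb_class_eq_iff vword_inv_cancel)
qed (use assms in \<open>auto simp: vb_carrier\<close>)

lemma vword_shift_0 [simp]: "vword_shift 0 w = w"
proof -
  have "vgen_shift 0 = id" by (rule ext, rename_tac g, case_tac g) auto
  then show ?thesis by (simp add: vword_shift_def map_prod.id)
qed

lemma vb_words_mono: "w \<in> vb_words m \<Longrightarrow> m \<le> n \<Longrightarrow> w \<in> vb_words n"
  by (auto simp: vb_words_def)

text \<open>The image over all words of a class avoids choosing a representative; it is a singleton
  on each class.\<close>

definition fixed_parity :: "vbraid \<Rightarrow> bool set" where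
  "fixed_parity = (\<lambda>(m, b). (\<lambda>w. even (card (fixed_colourings m w))) ` b)"

lemma fixed_parity_class:
  "fixed_parity (m, vb_class m w) = {even (card (fixed_colourings m w))}"
proof -
  have "even (card (fixed_colourings m w')) = even (card (fixed_colourings m w))"
    if "w' \<in> vb_class m w" for w'
    using word_act_equiv[of m w w'] that by (simp add: vb_class_def fixed_colourings_def)
  then have "(\<lambda>w. even (card (fixed_colourings m w))) ` vb_class m w
      = (\<lambda>_. even (card (fixed_colourings m w))) ` vb_class m w"
    by (rule image_cong[OF refl])
  also have "\<dots> = {even (card (fixed_colourings m w))}"
    using vb_class_self[of w m] by blast
  finally show ?thesis by (simp add: fixed_parity_def)
qed

lemma fixed_parity_VM0: "(x, y) \<in> VM0 \<Longrightarrow> fixed_parity x = fixed_parity y"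
proof -
  assume "(x, y) \<in> VM0"
  then obtain m w w' where *: "x = (m, vb_class m w)" "y = (m, vb_class m w')" "symclp (vb_step m) w w'"
    by (auto simp: VM0_def)
  then have "vb_class m w = vb_class m w'"
    by (metis equivclp_sym r_into_equivclp symclpE vb_class_eq_iff)
  with * show ?thesis by simp
qed

lemma fixed_parity_VM1: "(x, y) \<in> VM1 \<Longrightarrow> fixed_parity x = fixed_parity y"
  by (auto simp: VM1_def vb_carrier vb_inv_class vb_mult fixed_parity_class card_fixed_colourings_conj)

lemma fixed_parity_VM2_stab: "(x, y) \<in> VM2_stab \<Longrightarrow> fixed_parity x = fixed_parity y"
proof -
  assume "(x, y) \<in> VM2_stab"
  then obtain m w c where x: "x = (m, vb_class m w)" and w: "w \<in> vb_words m" and m: "m \<ge> 1"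
    and y: "y = (m + 1, vb_iota m 0 1 (vb_class m w) \<otimes>\<^bsub>VB (m + 1)\<^esub> c)"
    and c: "c \<in> {vb_sigma (m + 1) m, inv\<^bsub>VB (m + 1)\<^esub> vb_sigma (m + 1) m, vb_tau (m + 1) m}"
    by (auto simp: VM2_stab_def vb_carrier)
  have gen: "[(Sg m, e)] \<in> vb_words (Suc m)" "[(Tu m, e)] \<in> vb_words (Suc m)" for e
    using m by (auto simp: vb_words_def)
  have w': "w \<in> vb_words (Suc m)" using w vb_words_mono by force
  \<comment> \<open>The exponent \<open>e\<close> treats positive and negative stabilizations
    together.\<close>
  from c consider e where "c = vb_class (Suc m) [(Sg m, e)]" | "c = vb_class (Suc m) [tu m]"
    using gen by (auto simp: vb_inv_class vword_inv_def)
  then show ?thesis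
    by cases (simp_all add: x y vb_iota_class vb_mult w' gen fixed_parity_class
        even_card_fixed_colourings_stab_sigma[OF w m] even_card_fixed_colourings_stab_tau[OF w m])
qed

lemma fixed_parity_invariant:
  assumes "(x, y) \<in> (VM0 \<union> VM1 \<union> VM2)\<^sup>*"
  shows "fixed_parity x = fixed_parity y"
  using assms
proof (induction rule: rtrancl_induct)
  case (step y z)
  from step.hyps(2) consider "(y, z) \<in> VM0" | "(y, z) \<in> VM1" | "(y, z) \<in> VM2_stab" | "(z, y) \<in> VM2_stab"
    unfolding VM2_def by blast
  then have "fixed_parity y = fixed_parity z"
    by cases (simp_all add: fixed_parity_VM0 fixed_parity_VM1 fixed_parity_VM2_stab)
  with step.IH show ?case by simp
qed simp

section \<open>An exchange move on three strands\<close>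

definition triple :: "colour \<times> colour \<times> colour \<Rightarrow> nat \<Rightarrow> colour" where
  "triple = (\<lambda>(x, y, z). (\<lambda>_. undefined)(1 := x, 2 := y, 3 := z))"

lemma inj_triple: "inj triple"
proof (rule injI)
  fix p q assume "triple p = triple q"
  then have "triple p i = triple q i" for i by simp
  from this[of 1] this[of 2] this[of 3] show "p = q"
    by (auto simp: triple_def split: prod.splits)
qed

lemma colourings_3: "colourings 3 = range triple"
proof
  have "s = triple (s 1, s 2, s 3)" if "s \<in> colourings 3" for s
    using that by (auto simp: triple_def fun_eq_iff PiE_iff extensional_def)
  then show "colourings 3 \<subseteq> range triple" by blast
qed (auto simp: triple_def PiE_iff extensional_def)

lemma card_fixed_colourings_3:
  "card (fixed_colourings 3 w) = card {p. word_act w (triple p) = triple p}"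
proof -
  have "fixed_colourings 3 w = triple ` {p. word_act w (triple p) = triple p}"
    unfolding fixed_colourings_def colourings_3 by auto
  then show ?thesis by (simp add: card_image inj_on_subset[OF inj_triple])
qed

lemma pair_act_triple:
  "pair_act F (Suc 0) (triple (x, y, z)) = triple (fst (F (x, y)), snd (F (x, y)), z)"
  "pair_act F 2 (triple (x, y, z)) = triple (x, fst (F (y, z)), snd (F (y, z)))"
  by (auto simp: pair_act_def triple_def fun_eq_iff case_prod_beta)

text \<open>The words \<open>[tu 1, sg 1]\<close> and \<open>[sg 1, tu 1]\<close> act by mutually
  inverse maps that keep the colour at each place. If y and z have the same colour, both letters
  between and after them act trivially, whatever x is. This gives 4 * (1 + 9) = 40.\<close>

lemma even_card_sigma_exchange:
  "even (card (fixed_colourings 3 ([tu 1, sg 1] @ [(Sg 2, False)] @ [sg 1, tu 1] @ [sg 2])))"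
    (is "even (card (fixed_colourings 3 ?w))")
proof -
  have "word_act ?w (triple (x, y, z)) = triple (x, y, z) \<longleftrightarrow>
      (y = None \<and> z = None) \<or> (y \<noteq> None \<and> z \<noteq> None)" for x y z
    by (cases x; cases y; cases z) (auto simp: pair_act_triple inj_eq[OF inj_triple])
  then have "{p. word_act ?w (triple p) = triple p} =
      UNIV \<times> {(y, z). (y = None \<and> z = None) \<or> (y \<noteq> None \<and> z \<noteq> None)}"
    by auto
  then show ?thesis by (simp add: card_fixed_colourings_3 card_cartesian_product card_UNIV_option)
qed

text \<open>On three A-states the word acts as a cyclic rotation, fixing the 3 constant triples. If
  x is B and y, z are A, their labels become y + 1 and z - 1, so nothing is fixed. The 4 triples
  with y and z both B survive: 4 + 3 = 7.\<close>

lemma odd_card_tau_exchange: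
  "odd (card (fixed_colourings 3 ([tu 1, sg 1] @ [tu 2] @ [sg 1, tu 1] @ [tu 2])))"
    (is "odd (card (fixed_colourings 3 ?w))")
proof -
  have "word_act ?w (triple p) = triple p \<longleftrightarrow>
      p \<in> range (\<lambda>x. (x, None, None)) \<union> range (\<lambda>a. (Some a, Some a, Some a))" for p
  proof -
    obtain x y z where p: "p = (x, y, z)" by (cases p)
    show ?thesis
      unfolding p by (cases x; cases y; cases z) (auto simp: pair_act_triple inj_eq[OF inj_triple])
  qed
  then have "{p. word_act ?w (triple p) = triple p} =
      range (\<lambda>x. (x, None, None)) \<union> range (\<lambda>a. (Some a, Some a, Some a))"
    by (simp only: Collect_mem_eq)
  moreover have "card (range (\<lambda>x::colour. (x, None::colour, None::colour)) \<union>
      range (\<lambda>a::3. (Some a, Some a, Some a))) = 7"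
    by (subst card_Un_disjoint) (auto simp: card_image inj_def card_UNIV_option)
  ultimately show ?thesis by (simp add: card_fixed_colourings_3)
qed

theorem proposition3p3:
  "\<exists>x y. (x, y) \<in> VM3 \<and> (x, y) \<notin> (VM0 \<union> VM1 \<union> VM2)\<^sup>*"
proof -
  \<comment> \<open>A right exchange with m = 2, where \<open>c\<close> and \<open>d\<close> are the
    exchanged letters on strands 2 and 3.\<close>
  let ?b = "\<lambda>c d. (3, vb_class 3 ([tu 1, sg 1] @ [c] @ [sg 1, tu 1] @ [d]))"
  let ?x = "?b (Sg 2, False) (sg 2)" and ?y = "?b (tu 2) (tu 2)"
  have "(?x, ?y) \<in> VM3_right"
    unfolding VM3_right_def
    by (rule CollectI, rule exI[of _ 2], rule exI[of _ "vb_class 2 [tu 1, sg 1]"],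
        rule exI[of _ "vb_class 2 [sg 1, tu 1]"])
      (simp add: vb_iota_class vb_mult vb_inv_class vword_inv_def vb_carrier vb_words_def)
  then have "(?x, ?y) \<in> VM3" by (simp only: VM3_def Un_iff simp_thms)
  moreover have "fixed_parity ?x \<noteq> fixed_parity ?y"
    using even_card_sigma_exchange odd_card_tau_exchange by (simp only: fixed_parity_class) simp
  then have "(?x, ?y) \<notin> (VM0 \<union> VM1 \<union> VM2)\<^sup>*"
    by (rule contrapos_nn) (rule fixed_parity_invariant)
  ultimately show ?thesis by (intro exI conjI)
qed

end
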